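(* Let Algorithm 1 (described in the context) be run with parameters $\alpha=2$ and $\mu=\frac{33-\sqrt{738}}{27}\approx 0.216$. Then Algorithm 1 is $\frac{27}{33-\sqrt{738}}$-competitive, where $\frac{27}{33-\sqrt{738}}<4.63$, for task graphs following the general speedup model. That is, for every number $P\ge 1$ of processors and every finite directed acyclic graph of moldable tasks whose execution times have the form $t_j(p)=\frac{w_j}{\min(p,\bar p_j)}+d_j+c_j(p-1)$, the makespan $T$ produced by the algorithm satisfies $T\le \frac{27}{33-\sqrt{738}}\,T^{\mathrm{opt}}$, where $T^{\mathrm{opt}}$ is the optimal offline makespan.
   Context: Problem. A finite DAG $G=(V,E)$ of tasks is to be executed on $P$ identical processors. An edge $(i,j)$ means that task $j$ cannot start before task $i$ is completed. Tasks are moldable: when task $j$ starts, an integer number $p\in\{1,\dots,P\}$ of processors is chosen for it; it then runs without interruption on exactly $p$ processors for time $t_j(p)$. At any time at most $P$ processors are in use. Online setting: a task becomes available (and its parameters become known) only when all its predecessors are completed. The makespan is the completion time of the last task; $T^{\mathrm{opt}}$ is the minimum makespan over all feasible (offline) schedules. General model: $t_j(p)=\frac{w_j}{\min(p,\bar p_j)}+d_j+c_j(p-1)$ with reals $w_j,d_j,c_j\ge0$, $w_j+d_j>0$, and an integer $\bar p_j\ge1$. The area is $a_j(p)=p\,t_j(p)$. Put $p_j^{\max}=\min(P,\bar p_j,\tilde p_j)$, where, with $s_j=\sqrt{w_j/c_j}$, $\tilde p_j=\lfloor s_j\rfloor$ if $t_j(\lfloor s_j\rfloor)\le t_j(\lceil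 s_j\rceil)$ and $\tilde p_j=\lceil s_j\rceil$ otherwise (conventions: $\tilde p_j=+\infty$ if $c_j=0$; $\tilde p_j=1$ if $c_j>0$ and $s_j<1$). Put $t_j^{\min}=t_j(p_j^{\max})$, $a_j^{\min}=a_j(1)$. Algorithm 1 with parameters $\alpha\ge1$, $\mu\in(0,1/2]$. Processor allocation: when task $j$ becomes available, (Step 1) choose an initial allocation $p_j\in\{1,\dots,p_j^{\max}\}$ minimizing $t_j(p)/t_j^{\min}$ subject to $a_j(p)/a_j^{\min}\le\alpha$; (Step 2) the final allocation is $p_j'=\min(p_j,\lceil\mu P\rceil)$. The task is then inserted into a waiting queue (in arbitrary order). List scheduling: at time $0$ and whenever a running task completes, after newly available tasks have been inserted, scan all tasks in the queue and start each task $j$ immediately on $p'_j$ processors if at least $p'_j$ processors are idle. *)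

theory Defs
  imports Complex_Main
begin

section \<open>Moldable tasks: general speedup model\<close>

record moldable_task =
  par_work :: real
  seq_work :: real
  comm_cost :: real
  max_degree :: nat

definition valid_task :: "moldable_task \<Rightarrow> bool" where
  "valid_task k \<longleftrightarrow> par_work k \<ge> 0 \<and> seq_work k \<ge> 0 \<and> comm_cost k \<ge> 0
     \<and> par_work k + seq_work k > 0 \<and> max_degree k \<ge> 1"

definition exec_time :: "moldable_task \<Rightarrow> nat \<Rightarrow> real" where
  "exec_time k p = par_work k / real (min p (max_degree k)) + seq_work k + comm_cost k * (real p - 1)"

definition area :: "moldable_task \<Rightarrow> nat \<Rightarrow> real" where
  "area k p = real p * exec_time k p"

text \<open>The value of \<open>comm_degree\<close> is only meaningful for \<open>comm_cost k > 0\<close>; for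
  \<open>comm_cost k = 0\<close> it is conventionally infinite, which \<open>p_max\<close> renders by dropping it
  from the minimum.\<close>

definition comm_degree :: "moldable_task \<Rightarrow> nat" where
  "comm_degree k =
     (let s = sqrt (par_work k / comm_cost k) in
      if s < 1 then 1
      else if exec_time k (nat \<lfloor>s\<rfloor>) \<le> exec_time k (nat \<lceil>s\<rceil>) then nat \<lfloor>s\<rfloor>
      else nat \<lceil>s\<rceil>)"

definition p_max :: "nat \<Rightarrow> moldable_task \<Rightarrow> nat" where
  "p_max P k =
     (if comm_cost k = 0 then min P (max_degree k)
      else min P (min (max_degree k) (comm_degree k)))"

definition t_min :: "nat \<Rightarrow> moldable_task \<Rightarrow> real" where
  "t_min P k = exec_time k (p_max P k)"

definition a_min :: "moldable_task \<Rightarrow> real" where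
  "a_min k = area k 1"


section \<open>Task graphs, schedules and the offline optimum\<close>

definition task_graph :: "'a set \<Rightarrow> ('a \<times> 'a) set \<Rightarrow> ('a \<Rightarrow> moldable_task) \<Rightarrow> bool" where
  "task_graph V E k \<longleftrightarrow> finite V \<and> E \<subseteq> V \<times> V \<and> acyclic E \<and> (\<forall>j\<in>V. valid_task (k j))"

text \<open>A schedule is given by start times \<open>S\<close> and processor allocations \<open>q\<close>; only the values
  on the task set \<open>V\<close> matter.\<close>

definition finish :: "('a \<Rightarrow> moldable_task) \<Rightarrow> ('a \<Rightarrow> real) \<Rightarrow> ('a \<Rightarrow> nat) \<Rightarrow> 'a \<Rightarrow> real" where
  "finish k S q j = S j + exec_time (k j) (q j)"

definition feasible ::
  "nat \<Rightarrow> 'a set \<Rightarrow> ('a \<times> 'a) set \<Rightarrow> ('a \<Rightarrow> moldable_task) \<Rightarrow> ('a \<Rightarrow> real) \<Rightarrow> ('a \<Rightarrow> nat) \<Rightarrow> bool" where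
  "feasible P V E k S q \<longleftrightarrow>
     (\<forall>j\<in>V. 0 \<le> S j \<and> 1 \<le> q j \<and> q j \<le> P)
     \<and> (\<forall>(i, j)\<in>E. finish k S q i \<le> S j)
     \<and> (\<forall>x. (\<Sum>j | j \<in> V \<and> S j \<le> x \<and> x < finish k S q j. q j) \<le> P)"

text \<open>The inserted \<open>0\<close> only matters for the empty graph.\<close>

definition makespan ::
  "'a set \<Rightarrow> ('a \<Rightarrow> moldable_task) \<Rightarrow> ('a \<Rightarrow> real) \<Rightarrow> ('a \<Rightarrow> nat) \<Rightarrow> real" where
  "makespan V k S q = Max (insert 0 (finish k S q ` V))"

definition opt_makespan :: "nat \<Rightarrow> 'a set \<Rightarrow> ('a \<times> 'a) set \<Rightarrow> ('a \<Rightarrow> moldable_task) \<Rightarrow> real" where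
  "opt_makespan P V E k = Inf {makespan V k S q | S q. feasible P V E k S q}"


section \<open>The online algorithm\<close>

text \<open>\<open>allocation \<alpha> \<mu> P k p'\<close>: \<open>p'\<close> is a possible final allocation for a task \<open>k\<close>. It is a
  relation because the minimizer in the first step need not be unique.\<close>

definition initial_allocation :: "real \<Rightarrow> nat \<Rightarrow> moldable_task \<Rightarrow> nat \<Rightarrow> bool" where
  "initial_allocation \<alpha> P k p \<longleftrightarrow>
     is_arg_min (\<lambda>p. exec_time k p / t_min P k)
       (\<lambda>p. p \<in> {1..p_max P k} \<and> area k p / a_min k \<le> \<alpha>) p"

definition allocation :: "real \<Rightarrow> real \<Rightarrow> nat \<Rightarrow> moldable_task \<Rightarrow> nat \<Rightarrow> bool" where
  "allocation \<alpha> \<mu> P k p' \<longleftrightarrow>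
     (\<exists>p. initial_allocation \<alpha> P k p \<and> p' = min p (nat \<lceil>\<mu> * real P\<rceil>))"

text \<open>\<open>scan q idle Q\<close> passes once through the queue \<open>Q\<close> and returns the tasks that are started
  and those that keep waiting.\<close>

fun scan :: "('a \<Rightarrow> nat) \<Rightarrow> nat \<Rightarrow> 'a list \<Rightarrow> 'a list \<times> 'a list" where
  "scan q idle [] = ([], [])"
| "scan q idle (j # js) =
     (if q j \<le> idle
      then (let (started, waiting) = scan q (idle - q j) js in (j # started, waiting))
      else (let (started, waiting) = scan q idle js in (started, j # waiting)))"

text \<open>\<open>start\<close> and \<open>procs\<close> record the schedule built so far; \<open>start j\<close> is meaningful once \<open>j\<close> has
  been started, \<open>procs j\<close> (the final allocation) once \<open>j\<close> has become available.\<close>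

record 'a state =
  clock :: real
  queue :: "'a list"
  running :: "'a set"
  completed :: "'a set"
  start :: "'a \<Rightarrow> real"
  procs :: "'a \<Rightarrow> nat"

definition initial_state :: "'a state" where
  "initial_state = \<lparr>clock = 0, queue = [], running = {}, completed = {},
     start = (\<lambda>_. 0), procs = (\<lambda>_. 0)\<rparr>"

definition newly_available :: "'a set \<Rightarrow> ('a \<times> 'a) set \<Rightarrow> 'a state \<Rightarrow> 'a set" where
  "newly_available V E s =
     {j \<in> V. (\<forall>i. (i, j) \<in> E \<longrightarrow> i \<in> completed s)
        \<and> j \<notin> set (queue s) \<and> j \<notin> running s \<and> j \<notin> completed s}"

text \<open>The reaction of the algorithm at the current time: allocate processors to the newly
  available tasks, insert them into the queue (whose order \<open>Q\<close> is arbitrary), and scan the queue.\<close>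

definition react ::
  "real \<Rightarrow> real \<Rightarrow> nat \<Rightarrow> 'a set \<Rightarrow> ('a \<times> 'a) set \<Rightarrow> ('a \<Rightarrow> moldable_task) \<Rightarrow> 'a state \<Rightarrow> 'a state \<Rightarrow> bool"
where
  "react \<alpha> \<mu> P V E k s s' \<longleftrightarrow>
     (\<exists>q Q started waiting.
        (\<forall>j\<in>newly_available V E s. allocation \<alpha> \<mu> P (k j) (q j))
        \<and> (\<forall>j. j \<notin> newly_available V E s \<longrightarrow> q j = procs s j)
        \<and> distinct Q \<and> set Q = set (queue s) \<union> newly_available V E s
        \<and> scan q (P - (\<Sum>j\<in>running s. q j)) Q = (started, waiting)
        \<and> s' = s\<lparr>queue := waiting,
                 running := running s \<union> set started,
                 start := (\<lambda>j. if j \<in> set started then clock s else start s j),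
                 procs := q\<rparr>)"

text \<open>Advance to the next time at which a running task completes; all tasks completing at that
  time are completed together.\<close>

definition advance :: "('a \<Rightarrow> moldable_task) \<Rightarrow> 'a state \<Rightarrow> 'a state" where
  "advance k s =
     (let x = Min (finish k (start s) (procs s) ` running s);
          F = {j \<in> running s. finish k (start s) (procs s) j = x}
      in s\<lparr>clock := x, running := running s - F, completed := completed s \<union> F\<rparr>)"

inductive reachable ::
  "real \<Rightarrow> real \<Rightarrow> nat \<Rightarrow> 'a set \<Rightarrow> ('a \<times> 'a) set \<Rightarrow> ('a \<Rightarrow> moldable_task) \<Rightarrow> 'a state \<Rightarrow> bool"
  for \<alpha> \<mu> P V E k
where
  init: "react \<alpha> \<mu> P V E k initial_state s \<Longrightarrow> reachable \<alpha> \<mu> P V E k s"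
| step: "reachable \<alpha> \<mu> P V E k s \<Longrightarrow> running s \<noteq> {} \<Longrightarrow> react \<alpha> \<mu> P V E k (advance k s) s'
         \<Longrightarrow> reachable \<alpha> \<mu> P V E k s'"

text \<open>\<open>produces \<alpha> \<mu> P V E k T\<close>: some execution of the algorithm, i.e. some choice of tie-breaking
  and queue order, terminates with makespan \<open>T\<close>. An execution ends when no task is running, since
  then no further completion can occur; for a valid task graph all tasks are completed at that
  point, because a queued task always fits on \<open>P\<close> idle processors.\<close>

definition produces ::
  "real \<Rightarrow> real \<Rightarrow> nat \<Rightarrow> 'a set \<Rightarrow> ('a \<times> 'a) set \<Rightarrow> ('a \<Rightarrow> moldable_task) \<Rightarrow> real \<Rightarrow> bool" where
  "produces \<alpha> \<mu> P V E k T \<longleftrightarrow>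
     (\<exists>s. reachable \<alpha> \<mu> P V E k s \<and> running s = {} \<and> T = makespan V k (start s) (procs s))"

end

theory Submission
  imports Defs "HOL-Analysis.Analysis"
begin

text \<open>Follow the deficit \<open>(1 - \<mu>) * clock - work / P\<close> during a run. While a task is waiting, more than
  \<open>P - \<lceil>\<mu> P\<rceil>\<close> processors are busy, so the deficit does not grow; while a task is running, it grows
  at a rate of at most \<open>1 - \<mu>\<close>, and at most \<open>1 - 2 \<mu>\<close> if the task holds at least \<open>\<mu> P\<close> processors.
  A task becomes available at the completion of its last predecessor, so the final deficit is paid
  for by the tasks of a single chain. On this chain the charged time plus the area per processor of
  a task is at most \<open>(1 / \<mu> - 3) * exec_time k r + 2 * area k r / P\<close> for every allocation \<open>r\<close>, and off
  the chain the area is at most \<open>2 * area k r\<close>. In a feasible schedule both the time along a chain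
  and the total area per processor are bounded by the makespan \<open>M\<close>, whence
  \<open>(1 - \<mu>) * T \<le> (1 / \<mu> - 1) * M\<close>. The task-wise estimate needs \<open>2 * (1 - \<mu>) \<le> 1 / \<mu> - 3\<close>, where the
  factor \<open>2\<close> on the left is the loss in execution time of the initial allocation against \<open>t_min\<close>.\<close>

section \<open>Execution time and area\<close>

text \<open>One more processor lowers the parallel part by \<open>w / (p (p + 1))\<close> and raises
  the overhead by \<open>c\<close>; the sign of this difference decides all monotonicity questions
  below.\<close>

lemma exec_time_Suc:
  assumes "1 \<le> p" "p < max_degree k"
  shows "exec_time k (Suc p) = exec_time k p + comm_cost k - par_work k / (real p * (real p + 1))"
proof -
  have "w / (x + 1) = w / x - w / (x * (x + 1))" if "0 < x" for w x :: real
    using that by (simp add: divide_simps) (simp add: algebra_simps)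
  from this[of "real p" "par_work k"]
  have "par_work k / (real p + 1) = par_work k / real p - par_work k / (real p * (real p + 1))"
    using assms by simp
  then show ?thesis
    using assms by (simp add: exec_time_def algebra_simps min_def)
qed

lemma exec_time_Suc_ge_max_degree:
  "max_degree k \<le> p \<Longrightarrow> exec_time k (Suc p) = exec_time k p + comm_cost k"
  by (simp add: exec_time_def algebra_simps min_def)

lemma exec_time_nonneg:
  "valid_task k \<Longrightarrow> 1 \<le> p \<Longrightarrow> 0 \<le> exec_time k p"
  by (simp add: exec_time_def valid_task_def)

lemma exec_time_pos:
  assumes "valid_task k" "1 \<le> p"
  shows "0 < exec_time k p"
proof -
  have m: "0 < real (min p (max_degree k))" using assms by (simp add: valid_task_def)
  have c: "0 \<le> comm_cost k * (real p - 1)" using assms by (simp add: valid_task_def)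
  show ?thesis
  proof (cases "par_work k = 0")
    case True
    then have "exec_time k p = seq_work k + comm_cost k * (real p - 1)"
      by (simp add: exec_time_def)
    then show ?thesis using assms c True unfolding valid_task_def by linarith
  next
    case False
    then have "0 < par_work k / real (min p (max_degree k))"
      using assms m by (simp add: valid_task_def)
    then show ?thesis using assms c unfolding exec_time_def valid_task_def by linarith
  qed
qed

text \<open>The area is a nonnegative combination of \<open>p / min p m\<close>, \<open>p\<close>
  and \<open>p (p - 1)\<close> with \<open>m\<close> the maximal degree, and each of these is
  monotone.\<close>

lemma area_mono:
  assumes "valid_task k" "1 \<le> p" "p \<le> q"
  shows "area k p \<le> area k q"
proof -
  have "area k p = par_work k * (real p / real (min p (max_degree k))) + seq_work k * real p
      + comm_cost k * (real p * (real p - 1))" for p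
    by (simp add: area_def exec_time_def algebra_simps)
  moreover have "real p / real (min p (max_degree k)) \<le> real q / real (min q (max_degree k))"
    using assms by (auto simp: min_def valid_task_def field_simps)
  moreover have "real p * (real p - 1) \<le> real q * (real q - 1)"
    using assms by (intro mult_mono) auto
  ultimately show ?thesis
    using assms by (simp only: valid_task_def) (intro add_mono mult_left_mono; simp)
qed

text \<open>With \<open>s = sqrt (w / c)\<close>, every step with \<open>p + 1 \<le> s\<close> has
  \<open>p (p + 1) \<le> w / c\<close>. The only other step goes from the floor to the ceiling of
  \<open>s\<close>, and then rounding up was chosen because it is faster.\<close>

lemma exec_time_decr_below_comm_degree:
  assumes k: "valid_task k" "0 < comm_cost k"
    and p: "1 \<le> p" "p < comm_degree k" "p < max_degree k"
  shows "exec_time k (Suc p) \<le> exec_time k p"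
proof -
  define s where "s = sqrt (par_work k / comm_cost k)"
  have s2: "s * s = par_work k / comm_cost k"
    using k by (simp add: s_def valid_task_def)
  have s1: "1 \<le> s"
    using p by (auto simp: comm_degree_def Let_def s_def split: if_splits)
  show ?thesis
  proof (cases "p < nat \<lfloor>s\<rfloor>")
    case True
    then have "real p + 1 \<le> s" by linarith
    then have "real p * (real p + 1) \<le> s * s" by (intro mult_mono) auto
    then have "real p * (real p + 1) * comm_cost k \<le> par_work k"
      using k by (simp add: s2 field_simps)
    then have "comm_cost k \<le> par_work k / (real p * (real p + 1))"
      using p by (simp add: pos_le_divide_eq mult.commute)
    then show ?thesis using exec_time_Suc[of p k] p by simp
  next
    case False
    have "comm_degree k = (if exec_time k (nat \<lfloor>s\<rfloor>) \<le> exec_time k (nat \<lceil>s\<rceil>)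
        then nat \<lfloor>s\<rfloor> else nat \<lceil>s\<rceil>)"
      using s1 by (simp add: comm_degree_def Let_def s_def)
    with False p have "comm_degree k = nat \<lceil>s\<rceil>"
      and t: "exec_time k (nat \<lceil>s\<rceil>) \<le> exec_time k (nat \<lfloor>s\<rfloor>)"
      by (auto split: if_splits)
    moreover have "nat \<lceil>s\<rceil> \<le> Suc (nat \<lfloor>s\<rfloor>)" by linarith
    ultimately have "nat \<lceil>s\<rceil> = Suc p" "nat \<lfloor>s\<rfloor> = p" using False p by linarith+
    with t show ?thesis by simp
  qed
qed

text \<open>Mirror image: \<open>s \<le> p\<close> gives \<open>p (p + 1) \<ge> w / c\<close>, and
  \<open>p < s\<close> is possible only at the floor of \<open>s\<close>, when rounding down was
  preferred. From \<open>max_degree\<close> on, only the overhead changes.\<close>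

lemma exec_time_incr_above_comm_degree:
  assumes k: "valid_task k" "0 < comm_cost k"
    and p: "1 \<le> p" "comm_degree k \<le> p"
  shows "exec_time k p \<le> exec_time k (Suc p)"
proof (cases "p < max_degree k")
  case False
  then show ?thesis using exec_time_Suc_ge_max_degree[of k p] k by simp
next
  case m: True
  define s where "s = sqrt (par_work k / comm_cost k)"
  have s2: "s * s = par_work k / comm_cost k" and s0: "0 \<le> s"
    using k by (auto simp: s_def valid_task_def)
  show ?thesis
  proof (cases "s \<le> real p")
    case True
    then have "s * s \<le> real p * (real p + 1)" using s0 by (intro mult_mono) auto
    then have "par_work k \<le> real p * (real p + 1) * comm_cost k"
      using k by (simp add: s2 field_simps)
    then have "par_work k / (real p * (real p + 1)) \<le> comm_cost k"
      using p by (simp add: pos_divide_le_eq mult.commute)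
    then show ?thesis using exec_time_Suc[of p k] p m by simp
  next
    case False
    with p have s1: "\<not> s < 1" by linarith
    have "comm_degree k = (if exec_time k (nat \<lfloor>s\<rfloor>) \<le> exec_time k (nat \<lceil>s\<rceil>)
        then nat \<lfloor>s\<rfloor> else nat \<lceil>s\<rceil>)"
      using s1 by (simp add: comm_degree_def Let_def s_def)
    moreover have ps: "p < nat \<lceil>s\<rceil>" using False by linarith
    ultimately have "comm_degree k = nat \<lfloor>s\<rfloor>"
      and t: "exec_time k (nat \<lfloor>s\<rfloor>) \<le> exec_time k (nat \<lceil>s\<rceil>)"
      using p(2) by (metis not_le)+
    moreover have "nat \<lceil>s\<rceil> \<le> Suc (nat \<lfloor>s\<rfloor>)" by linarith
    ultimately have "nat \<lceil>s\<rceil> = Suc p" "nat \<lfloor>s\<rfloor> = p"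
      using p(2) ps by linarith+
    with t show ?thesis by simp
  qed
qed

lemma p_max_ge_1:
  assumes "valid_task k" "1 \<le> P"
  shows "1 \<le> p_max P k"
proof -
  have "1 \<le> nat \<lfloor>s\<rfloor>" "1 \<le> nat \<lceil>s\<rceil>" if "\<not> s < 1" for s :: real
    using that by linarith+
  then have "1 \<le> comm_degree k" unfolding comm_degree_def Let_def by presburger
  then show ?thesis using assms by (auto simp: p_max_def valid_task_def)
qed

lemma p_max_le: "p_max P k \<le> P" "p_max P k \<le> max_degree k"
  by (auto simp: p_max_def)

lemma exec_time_decr_below_p_max:
  assumes k: "valid_task k" and p: "1 \<le> p" "p \<le> q" "q \<le> p_max P k"
  shows "exec_time k q \<le> exec_time k p"
  using p(2,3)
proof (induction q rule: dec_induct)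
  case (step n)
  have m: "n < max_degree k" using step p_max_le(2)[of P k] by linarith
  have "exec_time k (Suc n) \<le> exec_time k n"
  proof (cases "comm_cost k = 0")
    case True
    then show ?thesis using exec_time_Suc[of n k] m step p k by (simp add: valid_task_def)
  next
    case False
    then have "n < comm_degree k" using step by (simp add: p_max_def)
    then show ?thesis
      using False exec_time_decr_below_comm_degree[of k n] m step p k by (simp add: valid_task_def)
  qed
  then show ?case using step by simp
qed simp

text \<open>Justifies the name \<open>t_min\<close>: the time does not increase up to
  \<open>p_max\<close> and does not decrease from there to \<open>P\<close>.\<close>

lemma t_min_le_exec_time:
  assumes k: "valid_task k" and p: "1 \<le> p" "p \<le> P"
  shows "t_min P k \<le> exec_time k p"
proof (cases "p \<le> p_max P k")
  case True
  then show ?thesis using exec_time_decr_below_p_max[OF k p(1)] by (auto simp: t_min_def)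
next
  case False
  then have "p_max P k \<le> p" by simp
  then show ?thesis using p(2) unfolding t_min_def
  proof (induction p rule: dec_induct)
    case (step n)
    have n1: "1 \<le> n" using step p_max_ge_1[OF k, of P] by linarith
    have "exec_time k n \<le> exec_time k (Suc n)"
    proof (cases "max_degree k \<le> n")
      case True
      then show ?thesis
        using exec_time_Suc_ge_max_degree k by (simp add: valid_task_def)
    next
      case False
      \<comment> \<open>Here \<open>n < P\<close> and \<open>n < max_degree k\<close>, so only
        \<open>comm_degree\<close> can have pushed \<open>p_max\<close> down to \<open>n\<close> or
        below.\<close>
      then have "comm_cost k \<noteq> 0" "comm_degree k \<le> n"
        using step by (auto simp: p_max_def split: if_splits)
      then show ?thesis
        using exec_time_incr_above_comm_degree[of k n] n1 k by (simp add: valid_task_def)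
    qed
    then show ?case using step by simp
  qed simp
qed


section \<open>Quality of the allocation\<close>

text \<open>If the area budget stops the allocation at \<open>q\<close>, then \<open>area k (Suc q) > 2 * area k 1\<close> forces
  \<open>w / q \<le> d + c (q + 1)\<close>, so that \<open>w / q + c (q - 1) \<le> d + 2 c (m - 1)\<close> for every \<open>m > q\<close>.\<close>

lemma initial_allocation_time_le:
  assumes k: "valid_task k" and P: "1 \<le> P" and p: "initial_allocation 2 P k p"
  shows "exec_time k p \<le> 2 * t_min P k"
proof -
  define m where "m = p_max P k"
  have m1: "1 \<le> m" using p_max_ge_1[OF k P] by (simp add: m_def)
  have tm: "0 < t_min P k" using exec_time_pos[OF k] m1 by (simp add: t_min_def m_def)
  have am: "0 < a_min k" using exec_time_pos[OF k, of 1] by (simp add: a_min_def area_def)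
  have best: "exec_time k p \<le> exec_time k q" if "q \<in> {1..m}" "area k q \<le> 2 * area k 1" for q
    using p that tm am
    by (auto simp: initial_allocation_def is_arg_min_linorder m_def a_min_def field_simps)
  \<comment> \<open>The largest allocation within the area budget serves as comparison: the
    minimizer of Step 1 is at least as fast.\<close>
  define q where "q = Max {q \<in> {1..m}. area k q \<le> 2 * area k 1}"
  have "area k 1 \<le> 2 * area k 1" using am by (simp add: a_min_def)
  then have "1 \<in> {q \<in> {1..m}. area k q \<le> 2 * area k 1}" using m1 by simp
  then have q: "q \<in> {q \<in> {1..m}. area k q \<le> 2 * area k 1}"
    unfolding q_def by (intro Max_in) auto
  show ?thesis
  proof (cases "q = m")
    case True
    then show ?thesis using best[of q] q tm by (simp add: t_min_def m_def)
  next
    case False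
    then have qm: "Suc q \<le> m" using q by simp
    have md: "m \<le> max_degree k" by (simp add: m_def p_max_le)
    have "\<not> area k (Suc q) \<le> 2 * area k 1"
    proof
      assume "area k (Suc q) \<le> 2 * area k 1"
      then have "Suc q \<le> q" unfolding q_def using qm q_def by (intro Max_ge) auto
      then show False by simp
    qed
    moreover have "real (Suc q) * (par_work k / real (Suc q)) = par_work k" by simp
    then have "area k (Suc q) = par_work k + seq_work k * (real q + 1)
        + comm_cost k * (real q * (real q + 1))"
      using qm md unfolding area_def exec_time_def
      by (simp add: min_def distrib_left) (simp add: algebra_simps)
    moreover have "area k 1 = par_work k + seq_work k"
      using k by (simp add: area_def exec_time_def min_def valid_task_def)
    ultimately have "par_work k + seq_work k * (real q + 1) + comm_cost k * (real q * (real q + 1))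
        > 2 * (par_work k + seq_work k)"
      by simp
    \<comment> \<open>The violated budget says \<open>w < d (q - 1) + c q (q + 1)\<close>; enlarging
      \<open>q - 1\<close> to \<open>q\<close> lets the factor \<open>q\<close> be divided
      out.\<close>
    then have "par_work k \<le> (seq_work k + comm_cost k * (real q + 1)) * real q"
      using k by (simp add: algebra_simps valid_task_def)
    then have w: "par_work k / real q \<le> seq_work k + comm_cost k * (real q + 1)"
      using q by (simp add: field_simps)
    have "0 \<le> par_work k / real m" using k by (simp add: valid_task_def)
    moreover have "comm_cost k * real q \<le> comm_cost k * (real m - 1)"
      using k qm by (intro mult_left_mono) (auto simp: valid_task_def)
    moreover have "exec_time k q = par_work k / real q + seq_work k + comm_cost k * (real q - 1)"
      and "exec_time k m = par_work k / real m + seq_work k + comm_cost k * (real m - 1)"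
      using q qm md by (auto simp: exec_time_def min_def)
    ultimately have "exec_time k q \<le> 2 * exec_time k m"
      using w by (simp add: algebra_simps)
    then show ?thesis using best[of q] q by (simp add: t_min_def m_def)
  qed
qed

lemma allocation_bounds:
  assumes "allocation \<alpha> \<mu> P k p" "0 < \<mu>" "1 \<le> P"
  shows "1 \<le> p" "p \<le> nat \<lceil>\<mu> * real P\<rceil>"
proof -
  have "0 < \<mu> * real P" using assms by simp
  then have "1 \<le> nat \<lceil>\<mu> * real P\<rceil>" by linarith
  then show "1 \<le> p" "p \<le> nat \<lceil>\<mu> * real P\<rceil>"
    using assms by (auto simp: allocation_def initial_allocation_def is_arg_min_def)
qed

text \<open>Step 1 respects the budget by definition, and the cap of Step 2 only lowers the
  area.\<close>

lemma allocation_area_le: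
  assumes k: "valid_task k" and P: "1 \<le> P" and \<mu>: "0 < \<mu>" and p: "allocation 2 \<mu> P k p"
  shows "area k p \<le> 2 * area k 1"
proof -
  obtain r where r: "initial_allocation 2 P k r" "p = min r (nat \<lceil>\<mu> * real P\<rceil>)"
    using p by (auto simp: allocation_def)
  have "0 < area k 1" using exec_time_pos[OF k, of 1] by (simp add: area_def)
  then have "area k r \<le> 2 * area k 1"
    using r by (auto simp: initial_allocation_def is_arg_min_def a_min_def field_simps)
  moreover have "area k p \<le> area k r"
    using r allocation_bounds[OF p \<mu> P] by (intro area_mono[OF k]) auto
  ultimately show ?thesis by simp
qed

text \<open>A bound on how fast \<open>(1 - \<mu>) * clock\<close> can outgrow the work done per processor while a task
  runs on \<open>p\<close> processors: a task on at least \<open>\<mu> P\<close> processors keeps a fraction \<open>\<mu>\<close> of the machine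
  busy by itself.\<close>

definition rate :: "real \<Rightarrow> nat \<Rightarrow> nat \<Rightarrow> real" where
  "rate \<mu> P p = (if real p < \<mu> * real P then 1 - \<mu> else 1 - 2 * \<mu>)"

text \<open>The cases differ in what pays. Below \<open>\<mu> P\<close> the time loss of factor 2 is
  covered by \<open>1 / \<mu> - 3\<close>. Otherwise, if \<open>p \<le> r\<close>, the area under
  \<open>r\<close> bounds both terms; if \<open>r < p\<close>, the task is no slower than under
  \<open>r\<close>, and the cap limits its area.\<close>

lemma allocation_tradeoff:
  assumes k: "valid_task k" and P: "1 \<le> P"
    and \<mu>: "0 < \<mu>" "\<mu> \<le> 1 / 2" "2 * \<mu> * (1 - \<mu>) \<le> 1 - 3 * \<mu>"
    and p: "allocation 2 \<mu> P k p" and r: "1 \<le> r" "r \<le> P"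
  shows "rate \<mu> P p * exec_time k p + area k p / real P
    \<le> (1 / \<mu> - 3) * exec_time k r + 2 * area k r / real P"
proof -
  obtain i where i: "initial_allocation 2 P k i" "p = min i (nat \<lceil>\<mu> * real P\<rceil>)"
    using p by (auto simp: allocation_def)
  have p1: "1 \<le> p" using allocation_bounds[OF p \<mu>(1) P] by simp
  have X: "2 * (1 - \<mu>) \<le> 1 / \<mu> - 3" using \<mu> by (simp add: field_simps)
  have tr: "0 \<le> exec_time k r" and tp: "0 \<le> exec_time k p"
    using exec_time_nonneg[OF k] r p1 by auto
  consider (small) "real p < \<mu> * real P" | (large_ge) "\<mu> * real P \<le> real p" "p \<le> r"
    | (large_less) "\<mu> * real P \<le> real p" "r < p"
    by linarith
  then show ?thesis
  proof cases
    case small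
    \<comment> \<open>The cap is at least \<open>\<mu> P\<close>, so it did not take effect.\<close>
    then have "p = i" using i by linarith
    then have "exec_time k p \<le> 2 * t_min P k"
      using initial_allocation_time_le[OF k P] i by simp
    also have "\<dots> \<le> 2 * exec_time k r" using t_min_le_exec_time[OF k r] by simp
    finally have "(1 - \<mu>) * exec_time k p \<le> (1 - \<mu>) * (2 * exec_time k r)"
      using \<mu> by (intro mult_left_mono) auto
    also have "\<dots> = 2 * (1 - \<mu>) * exec_time k r" by simp
    also have "\<dots> \<le> (1 / \<mu> - 3) * exec_time k r" using X tr by (rule mult_right_mono)
    finally have "(1 - \<mu>) * exec_time k p \<le> (1 / \<mu> - 3) * exec_time k r" .
    moreover have "area k p \<le> 2 * area k r"
      using allocation_area_le[OF k P \<mu>(1) p] area_mono[OF k order.refl r(1)] by simp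
    then have "area k p / real P \<le> 2 * area k r / real P" by (rule divide_right_mono) simp
    ultimately show ?thesis using small by (simp add: rate_def)
  next
    case large_ge
    have le: "area k p \<le> area k r" using area_mono[OF k p1 large_ge(2)] .
    have "exec_time k p * (\<mu> * real P) \<le> exec_time k p * real p"
      using large_ge tp by (intro mult_left_mono) auto
    also have "\<dots> \<le> area k r" using le by (simp add: area_def mult.commute)
    finally have "exec_time k p \<le> area k r / (\<mu> * real P)"
      using \<mu> P by (simp add: field_simps)
    then have "(1 - 2 * \<mu>) * exec_time k p \<le> (1 - 2 * \<mu>) * (area k r / (\<mu> * real P))"
      using \<mu> by (intro mult_left_mono) auto
    moreover have "area k p / real P \<le> area k r / real P" using le by (rule divide_right_mono) simp
    \<comment> \<open>The coefficients balance:
      \<open>(1 - 2 * \<mu>) / \<mu> + 1 = (1 / \<mu> - 3) + 2\<close>. The first share is then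
      turned into time, since \<open>r \<le> P\<close>.\<close>
    moreover have "(1 - 2 * \<mu>) * (area k r / (\<mu> * real P)) + area k r / real P
        = (1 / \<mu> - 3) * (area k r / real P) + 2 * area k r / real P"
      using \<mu> P by (simp add: field_simps)
    moreover have "area k r \<le> real P * exec_time k r"
      unfolding area_def using tr r by (intro mult_right_mono) auto
    then have "area k r / real P \<le> exec_time k r" using P by (simp add: field_simps)
    then have "(1 / \<mu> - 3) * (area k r / real P) \<le> (1 / \<mu> - 3) * exec_time k r"
      using X \<mu> by (intro mult_left_mono) auto
    ultimately show ?thesis using large_ge by (simp add: rate_def)
  next
    case large_less
    have "p \<le> p_max P k"
      using i by (auto simp: initial_allocation_def is_arg_min_def)
    then have t: "exec_time k p \<le> exec_time k r"
      using exec_time_decr_below_p_max[OF k r(1)] large_less by simp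
    have "p \<le> nat \<lceil>\<mu> * real P\<rceil>" using i by simp
    \<comment> \<open>The ceiling costs up to one processor; the resulting \<open>1 / P\<close> is
      absorbed by \<open>2 * r / P\<close> because \<open>1 \<le> r\<close>.\<close>
    then have "real p \<le> \<mu> * real P + 1" 
      using mult_nonneg_nonneg[of \<mu> "real P"] \<mu>(1) by linarith
    then have "real p / real P \<le> \<mu> + 1 / real P" using P by (simp add: field_simps)
    moreover have "1 / real P \<le> 2 * real r / real P" using r by (intro divide_right_mono) auto
    moreover have "1 - \<mu> \<le> 1 / \<mu> - 3" using \<mu>(2) by (intro order_trans[OF _ X]) simp
    ultimately have "1 - 2 * \<mu> + real p / real P \<le> 1 / \<mu> - 3 + 2 * real r / real P"
      by linarith
    moreover have "0 \<le> 1 / \<mu> - 3 + 2 * real r / real P" using X \<mu> by (intro add_nonneg_nonneg) auto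
    ultimately have "(1 - 2 * \<mu> + real p / real P) * exec_time k p
        \<le> (1 / \<mu> - 3 + 2 * real r / real P) * exec_time k r"
      using t tp by (intro mult_mono) auto
    then show ?thesis using large_less by (simp add: rate_def area_def algebra_simps)
  qed
qed


section \<open>Chains\<close>

text \<open>A directed path, kept as its vertex set together with its last vertex, so that charges
  along it are plain sums over a set.\<close>

inductive chain :: "('a \<times> 'a) set \<Rightarrow> 'a set \<Rightarrow> 'a \<Rightarrow> bool" for E where
  single: "chain E {j} j"
| extend: "chain E C i \<Longrightarrow> (i, j) \<in> E \<Longrightarrow> chain E (insert j C) j"

lemma chain_finite: "chain E C j \<Longrightarrow> finite C"
  by (induction rule: chain.induct) auto

lemma chain_rtrancl: "chain E C j \<Longrightarrow> i \<in> C \<Longrightarrow> (i, j) \<in> E\<^sup>*"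
proof (induction rule: chain.induct)
  case (extend C i' j)
  show ?case
  proof (cases "i = j")
    case False
    then have "(i, i') \<in> E\<^sup>*" using extend by simp
    then show ?thesis using extend(2) by (rule rtrancl_into_rtrancl)
  qed simp
qed simp

text \<open>Otherwise the edge would close a cycle. Hence extending a chain adds exactly one new
  summand to any sum over it.\<close>

lemma chain_extend_fresh:
  assumes "chain E C i" "(i, j) \<in> E" "acyclic E"
  shows "j \<notin> C"
proof
  assume "j \<in> C"
  then have "(j, i) \<in> E\<^sup>*" using assms(1) by (rule chain_rtrancl[rotated])
  then have "(j, j) \<in> E\<^sup>+" using assms(2) by (rule rtrancl_into_trancl1)
  then show False using assms(3) by (simp add: acyclic_def)
qed


section \<open>List scheduling\<close>

lemma scan_set: "scan q n Q = (a, b) \<Longrightarrow> set a \<union> set b = set Q"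
proof (induction q n Q arbitrary: a b rule: scan.induct)
  case (2 q n j js)
  show ?case
  proof (cases "q j \<le> n")
    case True
    then obtain a' where "scan q (n - q j) js = (a', b)" "a = j # a'"
      using 2(3) by (auto split: prod.splits)
    then show ?thesis using 2(1)[OF True, of a' b] by auto
  next
    case False
    then obtain b' where "scan q n js = (a, b')" "b = j # b'"
      using 2(3) by (auto split: prod.splits)
    then show ?thesis using 2(2)[OF False, of a b'] by auto
  qed
qed simp

lemma scan_distinct:
  "scan q n Q = (a, b) \<Longrightarrow> distinct Q \<Longrightarrow> distinct a \<and> set a \<inter> set b = {}"
proof (induction q n Q arbitrary: a b rule: scan.induct)
  case (2 q n j js)
  show ?case
  proof (cases "q j \<le> n")
    case True
    then obtain a' where a': "scan q (n - q j) js = (a', b)" "a = j # a'"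
      using 2(3) by (auto split: prod.splits)
    then show ?thesis using 2(1)[OF True, of a' b] 2(4) scan_set[OF a'(1)] by auto
  next
    case False
    then obtain b' where b': "scan q n js = (a, b')" "b = j # b'"
      using 2(3) by (auto split: prod.splits)
    then show ?thesis using 2(2)[OF False, of a b'] 2(4) scan_set[OF b'(1)] by auto
  qed
qed simp

text \<open>A task left waiting did not fit beside the tasks started before it in the scan; those
  started later only enlarge the sum.\<close>

lemma scan_waiting:
  "scan q n Q = (a, b) \<Longrightarrow> j \<in> set b \<Longrightarrow> n < q j + sum_list (map q a)"
proof (induction q n Q arbitrary: a b rule: scan.induct)
  case (2 q n i js)
  show ?case
  proof (cases "q i \<le> n")
    case True
    then obtain a' where "scan q (n - q i) js = (a', b)" "a = i # a'"
      using 2(3) by (auto split: prod.splits)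
    then show ?thesis using 2(1)[OF True, of a' b] 2(4) by auto
  next
    case False
    then obtain b' where "scan q n js = (a, b')" "b = i # b'"
      using 2(3) by (auto split: prod.splits)
    then show ?thesis using 2(2)[OF False, of a b'] 2(4) False by auto
  qed
qed simp

section \<open>Charging invariants along a run of the algorithm\<close>

locale list_scheduling =
  fixes P :: nat and V :: "'a set" and E :: "('a \<times> 'a) set" and k :: "'a \<Rightarrow> moldable_task"
    and \<alpha> \<mu> :: real
  assumes P: "1 \<le> P" and graph: "task_graph V E k" and \<mu>: "0 < \<mu>" "\<mu> \<le> 1 / 2"
begin

lemma finite_V: "finite V" and acyclic_E: "acyclic E" and E_subset: "E \<subseteq> V \<times> V"
  and valid: "j \<in> V \<Longrightarrow> valid_task (k j)"
  using graph by (auto simp: task_graph_def)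

abbreviation completion :: "'a state \<Rightarrow> 'a \<Rightarrow> real" where
  "completion s \<equiv> finish k (start s) (procs s)"

text \<open>The tasks that have become available, hence those on which \<open>procs\<close> is
  final.\<close>

definition active :: "'a state \<Rightarrow> 'a set" where
  "active s = set (queue s) \<union> running s \<union> completed s"

definition work :: "'a state \<Rightarrow> real" where
  "work s = (\<Sum>j\<in>completed s. area (k j) (procs s j))
     + (\<Sum>j\<in>running s. real (procs s j) * (clock s - start s j))"

definition deficit :: "'a state \<Rightarrow> real" where
  "deficit s = (1 - \<mu>) * clock s - work s / real P"

abbreviation weight :: "('a \<Rightarrow> nat) \<Rightarrow> 'a \<Rightarrow> real" where
  "weight q j \<equiv> rate \<mu> P (q j) * exec_time (k j) (q j)"

text \<open>A certificate that some chain ending in \<open>j\<close> pays for \<open>x\<close>.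
  Keeping the chain inside \<open>active s\<close> ensures that its weights no longer
  change.\<close>

definition chain_bounded :: "'a state \<Rightarrow> 'a \<Rightarrow> real \<Rightarrow> bool" where
  "chain_bounded s j x \<longleftrightarrow>
     (\<exists>C. chain E C j \<and> C \<subseteq> active s \<and> x \<le> (\<Sum>i\<in>C. weight (procs s) i))"

definition well_formed :: "'a state \<Rightarrow> bool" where
  "well_formed s \<longleftrightarrow> active s \<subseteq> V
     \<and> set (queue s) \<inter> (running s \<union> completed s) = {} \<and> running s \<inter> completed s = {}
     \<and> (\<forall>j\<in>active s. allocation \<alpha> \<mu> P (k j) (procs s j))
     \<and> (\<forall>j\<in>running s. clock s \<le> completion s j)
     \<and> (\<forall>j\<in>completed s. completion s j \<le> clock s)"

text \<open>Each task is charged in advance for all the deficit that can still build up until it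
  completes. A queued task is charged for its execution only, since the deficit does not grow
  while a task is waiting.\<close>

definition deficit_charged :: "'a state \<Rightarrow> bool" where
  "deficit_charged s \<longleftrightarrow>
     (\<forall>j\<in>running s. chain_bounded s j
        (deficit s + rate \<mu> P (procs s j) * (completion s j - clock s)))
     \<and> (\<forall>j\<in>set (queue s). chain_bounded s j (deficit s + weight (procs s) j))
     \<and> (\<forall>j\<in>newly_available V E s. deficit s \<le> 0
        \<or> (\<exists>i. (i, j) \<in> E \<and> chain_bounded s i (deficit s)))
     \<and> (clock s = 0 \<or> (\<exists>j\<in>completed s. chain_bounded s j (deficit s)))"

text \<open>Describes a state right after a scan, as opposed to one right after
  \<open>advance\<close>. The load bound is what keeps the deficit from growing while a task
  waits.\<close>

definition settled :: "'a state \<Rightarrow> bool" where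
  "settled s \<longleftrightarrow> newly_available V E s = {}
     \<and> (queue s \<noteq> [] \<longrightarrow> (1 - \<mu>) * real P \<le> real (\<Sum>j\<in>running s. procs s j))"

lemma chain_bounded_mono:
  assumes "chain_bounded s j x" "y \<le> x" "active s \<subseteq> active s'"
    and "\<And>i. i \<in> active s \<Longrightarrow> procs s' i = procs s i"
  shows "chain_bounded s' j y"
proof -
  obtain C where C: "chain E C j" "C \<subseteq> active s" "x \<le> (\<Sum>i\<in>C. weight (procs s) i)"
    using assms(1) by (auto simp: chain_bounded_def)
  moreover have "(\<Sum>i\<in>C. weight (procs s') i) = (\<Sum>i\<in>C. weight (procs s) i)"
    using C(2) assms(4) by (intro sum.cong) auto
  ultimately show ?thesis using assms(2,3) unfolding chain_bounded_def by (intro exI[of _ C]) auto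
qed

lemma chain_bounded_single:
  assumes "j \<in> active s" "x \<le> weight (procs s) j"
  shows "chain_bounded s j x"
  using assms unfolding chain_bounded_def by (intro exI[of _ "{j}"]) (auto intro: chain.single)

lemma chain_bounded_extend:
  assumes "chain_bounded s i x" "(i, j) \<in> E" "j \<in> active s"
  shows "chain_bounded s j (x + weight (procs s) j)"
proof -
  obtain C where C: "chain E C i" "C \<subseteq> active s" "x \<le> (\<Sum>i\<in>C. weight (procs s) i)"
    using assms(1) by (auto simp: chain_bounded_def)
  moreover have "j \<notin> C" using chain_extend_fresh[OF C(1) assms(2) acyclic_E] .
  ultimately show ?thesis
    using assms chain_finite[OF C(1)] unfolding chain_bounded_def
    by (intro exI[of _ "insert j C"]) (auto intro: chain.extend)
qed

text \<open>A reaction takes no time, so the deficit is unchanged. A new task prolongs the chain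
  that pays for one of its predecessors, or begins a chain if there is no positive deficit to
  pay.\<close>

lemma react_preserves:
  assumes wf: "well_formed s" and charged: "deficit_charged s" and react: "react \<alpha> \<mu> P V E k s s'"
  shows "well_formed s' \<and> deficit_charged s' \<and> settled s'"
proof -
  define N where "N = newly_available V E s"
  obtain q Q st wt where
    q: "\<And>j. j \<in> N \<Longrightarrow> allocation \<alpha> \<mu> P (k j) (q j)" "\<And>j. j \<notin> N \<Longrightarrow> q j = procs s j"
    and Q: "distinct Q" "set Q = set (queue s) \<union> N"
    and scan: "scan q (P - (\<Sum>j\<in>running s. q j)) Q = (st, wt)"
    and s': "s' = s\<lparr>queue := wt, running := running s \<union> set st,
      start := (\<lambda>j. if j \<in> set st then clock s else start s j), procs := q\<rparr>"
    using react unfolding react_def N_def by blast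
  have s'_simps [simp]: "queue s' = wt" "running s' = running s \<union> set st"
      "completed s' = completed s" "clock s' = clock s" "procs s' = q"
      "start s' = (\<lambda>j. if j \<in> set st then clock s else start s j)"
    by (simp_all add: s')
  have N: "N \<inter> active s = {}" "N \<subseteq> V"
    by (auto simp: N_def newly_available_def active_def)
  have split: "set st \<union> set wt = set (queue s) \<union> N"
    using scan_set[OF scan] Q by simp
  have dst: "distinct st" "set st \<inter> set wt = {}"
    using scan_distinct[OF scan Q(1)] by auto
  have active': "active s' = active s \<union> N"
    using split by (auto simp: active_def)
  have disj: "set (queue s) \<inter> (running s \<union> completed s) = {}" "running s \<inter> completed s = {}"
    using wf by (auto simp: well_formed_def)
  have new_disj: "(set st \<union> set wt) \<inter> (running s \<union> completed s) = {}"
    using split disj N by (auto simp: active_def)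
  have V: "active s' \<subseteq> V" using wf N active' by (auto simp: well_formed_def)
  have fin: "finite (running s)" "finite (completed s)"
    using wf finite_V by (auto simp: well_formed_def active_def intro: finite_subset)
  have q_old: "q j = procs s j" if "j \<in> active s" for j
    using that N q(2) by auto
  have alloc: "allocation \<alpha> \<mu> P (k j) (q j)" if "j \<in> active s'" for j
    using that q(1) q_old[of j] wf by (auto simp: active' well_formed_def)
  have completion_old: "completion s' j = completion s j" if "j \<in> running s \<union> completed s" for j
  proof -
    have "j \<notin> set st" using that new_disj by blast
    then show ?thesis using that q_old[of j] by (auto simp: finish_def active_def)
  qed
  have completion_new: "completion s' j = clock s + exec_time (k j) (q j)" if "j \<in> set st" for j
    using that by (simp add: finish_def)
  have st_active: "set st \<subseteq> active s'" by (auto simp: active_def)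
  have wf': "well_formed s'"
    unfolding well_formed_def
  proof (intro conjI ballI)
    fix j assume j: "j \<in> running s'"
    show "clock s' \<le> completion s' j"
    proof (cases "j \<in> set st")
      case True
      then have "1 \<le> q j" "j \<in> V"
        using allocation_bounds[OF alloc \<mu>(1) P, of j] st_active V by auto
      then show ?thesis
        using completion_new[OF True] exec_time_nonneg[OF valid] by simp
    next
      case False
      then show ?thesis using j completion_old[of j] wf by (auto simp: well_formed_def)
    qed
  next
    fix j assume "j \<in> completed s'"
    then show "completion s' j \<le> clock s'"
      using completion_old[of j] wf by (auto simp: well_formed_def)
  qed (use V alloc new_disj dst disj in auto)
  \<comment> \<open>The tasks just started have run for no time yet.\<close>
  have "work s' = work s"
  proof -
    have "(\<Sum>j\<in>running s'. real (q j) * (clock s - start s' j))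
        = (\<Sum>j\<in>running s. real (q j) * (clock s - start s' j))
          + (\<Sum>j\<in>set st. real (q j) * (clock s - start s' j))"
      using fin new_disj by (simp add: sum.union_disjoint Int_commute Int_Un_distrib)
    also have "(\<Sum>j\<in>set st. real (q j) * (clock s - start s' j)) = 0"
      by (intro sum.neutral) auto
    also have "(\<Sum>j\<in>running s. real (q j) * (clock s - start s' j))
        = (\<Sum>j\<in>running s. real (procs s j) * (clock s - start s j))"
      using new_disj by (intro sum.cong) (auto simp: q_old active_def)
    finally show ?thesis
      by (auto simp: work_def q_old active_def intro!: sum.cong)
  qed
  then have deficit': "deficit s' = deficit s" by (simp add: deficit_def)
  have bounded_old: "chain_bounded s' j x" if "chain_bounded s j x" for j x
    using that by (rule chain_bounded_mono) (auto simp: active' q_old)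
  \<comment> \<open>The same charge serves a task that keeps waiting and one that starts now, as the
    latter still has its full execution time ahead.\<close>
  have bounded_new: "chain_bounded s' j (deficit s' + weight q j)" if j: "j \<in> set (queue s) \<union> N" for j
  proof (cases "j \<in> set (queue s)")
    case True
    then have "chain_bounded s j (deficit s + weight (procs s) j)"
      using charged by (auto simp: deficit_charged_def)
    then show ?thesis using bounded_old[of j] True q_old[of j] by (simp add: deficit' active_def)
  next
    case False
    then have jN: "j \<in> N" using j by simp
    then have ja: "j \<in> active s'" by (simp add: active')
    from jN consider "deficit s \<le> 0" | i where "(i, j) \<in> E" "chain_bounded s i (deficit s)"
      using charged by (auto simp: deficit_charged_def N_def)
    then show ?thesis
    proof cases
      case 1
      then show ?thesis using ja by (intro chain_bounded_single) (auto simp: deficit')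
    next
      case 2
      then show ?thesis using chain_bounded_extend[of s' i "deficit s" j] bounded_old ja
        by (simp add: deficit')
    qed
  qed
  have newly': "newly_available V E s' = {}"
    using split by (auto simp: newly_available_def N_def)
  have charged': "deficit_charged s'"
    unfolding deficit_charged_def
  proof (intro conjI ballI)
    fix j assume j: "j \<in> running s'"
    show "chain_bounded s' j (deficit s' + rate \<mu> P (procs s' j) * (completion s' j - clock s'))"
    proof (cases "j \<in> set st")
      case True
      then show ?thesis using bounded_new[of j] split completion_new[OF True] by auto
    next
      case False
      then have jr: "j \<in> running s" using j by simp
      then have "chain_bounded s j
          (deficit s + rate \<mu> P (procs s j) * (completion s j - clock s))"
        using charged by (auto simp: deficit_charged_def)
      then show ?thesis
        using bounded_old[of j] completion_old[of j] q_old[of j] jr by (simp add: deficit' active_def)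
    qed
  next
    fix j assume "j \<in> set (queue s')"
    then show "chain_bounded s' j (deficit s' + weight (procs s') j)"
      using bounded_new[of j] split by auto
  next
    show "clock s' = 0 \<or> (\<exists>j\<in>completed s'. chain_bounded s' j (deficit s'))"
      using charged bounded_old unfolding deficit_charged_def deficit' s'_simps by blast
  qed (use newly' in simp)
  have "settled s'"
    unfolding settled_def
  proof (intro conjI impI)
    assume "queue s' \<noteq> []"
    then obtain j where j: "j \<in> set wt" by (cases wt) auto
    have "P - (\<Sum>j\<in>running s. q j) < q j + sum_list (map q st)"
      using scan_waiting[OF scan j] .
    \<comment> \<open>Valid for truncated subtraction too.\<close>
    then have "P < q j + sum_list (map q st) + (\<Sum>j\<in>running s. q j)" by linarith
    also have "sum_list (map q st) = (\<Sum>j\<in>set st. q j)"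
      using dst(1) by (rule sum_list_distinct_conv_sum_set)
    also have "q j + (\<Sum>j\<in>set st. q j) + (\<Sum>j\<in>running s. q j) = q j + (\<Sum>j\<in>running s'. q j)"
      using fin new_disj by (simp add: sum.union_disjoint Int_commute Int_Un_distrib)
    finally have "P < q j + (\<Sum>j\<in>running s'. q j)" .
    moreover have "q j \<le> nat \<lceil>\<mu> * real P\<rceil>"
      using allocation_bounds[OF alloc \<mu>(1) P, of j] j by (auto simp: active_def)
    moreover have "real (nat \<lceil>\<mu> * real P\<rceil>) < \<mu> * real P + 1"
      using mult_nonneg_nonneg[of \<mu> "real P"] \<mu>(1) by linarith
    \<comment> \<open>Strictness between integers yields one full unit, which offsets the
      \<open>+ 1\<close> from the ceiling.\<close>
    ultimately have "real P - \<mu> * real P < real (\<Sum>j\<in>running s'. q j)" by linarith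
    then show "(1 - \<mu>) * real P \<le> real (\<Sum>j\<in>running s'. procs s' j)"
      by (simp add: algebra_simps)
  qed (fact newly')
  with wf' charged' show ?thesis by simp
qed

text \<open>Until the next completion the number \<open>U\<close> of busy processors is constant, so
  the deficit changes at rate \<open>1 - \<mu> - U / P\<close>. This is at most the
  \<open>rate\<close> of any running task, as \<open>U\<close> includes its processors, and is
  nonpositive if a task waits.\<close>

lemma advance_preserves:
  assumes wf: "well_formed s" and charged: "deficit_charged s" and settled: "settled s"
    and run: "running s \<noteq> {}"
  shows "well_formed (advance k s) \<and> deficit_charged (advance k s)"
proof -
  define x where "x = Min (completion s ` running s)"
  define F where "F = {j \<in> running s. completion s j = x}"
  define s' where "s' = advance k s"
  have s'_simps [simp]: "queue s' = queue s" "running s' = running s - F"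
      "completed s' = completed s \<union> F" "clock s' = x" "procs s' = procs s" "start s' = start s"
    by (simp_all add: s'_def advance_def Let_def x_def F_def)
  have fin: "finite (running s)" "finite (completed s)"
    using wf finite_V by (auto simp: well_formed_def active_def intro: finite_subset)
  have F: "F \<subseteq> running s" by (auto simp: F_def)
  have active': "active s' = active s" using F by (auto simp: active_def)
  have x_le: "x \<le> completion s j" if "j \<in> running s" for j
    using that fin by (auto simp: x_def)
  have "x \<in> completion s ` running s"
    unfolding x_def using fin run by (intro Min_in) auto
  then obtain i where i: "i \<in> F" by (auto simp: F_def)
  then have x_ge: "clock s \<le> x" using wf by (auto simp: well_formed_def F_def)
  have disj: "running s \<inter> completed s = {}" "set (queue s) \<inter> (running s \<union> completed s) = {}"
    using wf by (auto simp: well_formed_def)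
  define U where "U = real (\<Sum>j\<in>running s. procs s j)"
  have "work s' = (\<Sum>j\<in>completed s. area (k j) (procs s j)) + (\<Sum>j\<in>F. area (k j) (procs s j))
      + (\<Sum>j\<in>running s - F. real (procs s j) * (x - start s j))"
    using fin F disj by (simp add: work_def sum.union_disjoint finite_subset inf_assoc Int_absorb1)
       (subst sum.union_disjoint, auto intro: finite_subset)
  \<comment> \<open>A task finishing at \<open>x\<close> has run for exactly its execution time, so
    finishing and continuing tasks contribute by the same formula.\<close>
  also have "(\<Sum>j\<in>F. area (k j) (procs s j)) = (\<Sum>j\<in>F. real (procs s j) * (x - start s j))"
    by (intro sum.cong) (auto simp: area_def F_def finish_def)
  also have "(\<Sum>j\<in>completed s. area (k j) (procs s j))
      + (\<Sum>j\<in>F. real (procs s j) * (x - start s j))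
      + (\<Sum>j\<in>running s - F. real (procs s j) * (x - start s j))
      = (\<Sum>j\<in>completed s. area (k j) (procs s j))
        + (\<Sum>j\<in>running s. real (procs s j) * (x - start s j))"
    using sum.subset_diff[OF F fin(1), of "\<lambda>j. real (procs s j) * (x - start s j)"] by simp
  also have "(\<Sum>j\<in>running s. real (procs s j) * (x - start s j))
      = (\<Sum>j\<in>running s. real (procs s j) * (clock s - start s j)) + U * (x - clock s)"
    unfolding U_def of_nat_sum sum_distrib_right sum.distrib[symmetric]
    by (intro sum.cong) (auto simp: algebra_simps)
  finally have "work s' = work s + U * (x - clock s)" by (simp add: work_def)
  then have "work s' / real P = work s / real P + U / real P * (x - clock s)"
    by (simp add: add_divide_distrib)
  then have deficit': "deficit s' = deficit s + (1 - \<mu> - U / real P) * (x - clock s)"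
    by (simp add: deficit_def left_diff_distrib right_diff_distrib)
  have bounded: "chain_bounded s' j y" if "chain_bounded s j z" "y \<le> z" for j y z
    using that by (rule chain_bounded_mono) (auto simp: active')
  have running': "chain_bounded s' j
      (deficit s' + rate \<mu> P (procs s j) * (completion s j - x))" if j: "j \<in> running s" for j
  proof -
    have "real (procs s j) \<le> U"
      unfolding U_def of_nat_le_iff using j fin by (intro member_le_sum) auto
    then have "1 - \<mu> - U / real P \<le> rate \<mu> P (procs s j)"
      using P by (auto simp: rate_def field_simps U_def)
    then have "(1 - \<mu> - U / real P) * (x - clock s) \<le> rate \<mu> P (procs s j) * (x - clock s)"
      using x_ge by (intro mult_right_mono) auto
    then have "deficit s' + rate \<mu> P (procs s j) * (completion s j - x)
        \<le> deficit s + rate \<mu> P (procs s j) * (completion s j - clock s)"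
      by (simp add: deficit' algebra_simps)
    with j show ?thesis
      using charged by (intro bounded) (auto simp: deficit_charged_def)
  qed
  \<comment> \<open>A finishing task has no time left, so its advance charge has become a bound on
    the deficit itself.\<close>
  have F': "chain_bounded s' j (deficit s')" if "j \<in> F" for j
    using running'[of j] that by (auto simp: F_def)
  have "well_formed s'"
    unfolding well_formed_def active'
  proof (intro conjI ballI)
    fix j assume "j \<in> completed s'"
    then show "completion s' j \<le> clock s'"
      using wf x_ge by (auto simp: well_formed_def F_def finish_def intro: order_trans)
  qed (use wf x_le F disj in \<open>auto simp: well_formed_def finish_def\<close>)
  moreover have "deficit_charged s'"
    unfolding deficit_charged_def
  proof (intro conjI ballI)
    fix j assume "j \<in> running s'"
    then show "chain_bounded s' j (deficit s' + rate \<mu> P (procs s' j) * (completion s' j - clock s'))"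
      using running'[of j] by simp
  next
    fix j assume j: "j \<in> set (queue s')"
    then have "queue s \<noteq> []" by auto
    then have "(1 - \<mu>) * real P \<le> U" using settled by (simp add: settled_def U_def)
    then have "1 - \<mu> - U / real P \<le> 0" using P by (simp add: field_simps)
    then have "deficit s' \<le> deficit s"
      using x_ge by (simp add: deficit' mult_nonpos_nonneg)
    then show "chain_bounded s' j (deficit s' + weight (procs s') j)"
      using j charged by (intro bounded) (auto simp: deficit_charged_def)
  next
    fix j assume j: "j \<in> newly_available V E s'"
    \<comment> \<open>Availability can only be due to a predecessor that finished just now, and that
      predecessor passes its chain on.\<close>
    have "j \<notin> newly_available V E s" using settled by (simp add: settled_def)
    then obtain i where "(i, j) \<in> E" "i \<in> F"
      using j F by (auto simp: newly_available_def)
    then show "deficit s' \<le> 0 \<or> (\<exists>i. (i, j) \<in> E \<and> chain_bounded s' i (deficit s'))"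
      using F' by blast
  next
    show "clock s' = 0 \<or> (\<exists>j\<in>completed s'. chain_bounded s' j (deficit s'))"
      using F' i by auto
  qed
  ultimately show ?thesis by (simp add: s'_def)
qed

lemma reachable_invariant:
  "reachable \<alpha> \<mu> P V E k s \<Longrightarrow> well_formed s \<and> deficit_charged s \<and> settled s"
proof (induction rule: reachable.induct)
  case (init s)
  \<comment> \<open>At time 0 the deficit is 0, so the sources of the graph can begin their own
    chains.\<close>
  have "well_formed initial_state" "deficit_charged initial_state"
    by (auto simp: well_formed_def deficit_charged_def initial_state_def active_def deficit_def
        work_def)
  then show ?case using init react_preserves by blast
next
  case (step s s')
  then show ?case using advance_preserves react_preserves by blast
qed

text \<open>A waiting task would force a positive load while nothing runs. With an empty queue,
  induction along the edges completes every task, since none is newly available.\<close>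

lemma terminal_completed:
  assumes "well_formed s" "settled s" "running s = {}"
  shows "queue s = []" "completed s = V"
proof -
  have "0 < (1 - \<mu>) * real P" using P \<mu> by simp
  then show q: "queue s = []" using assms(2,3) by (auto simp: settled_def)
  have "finite E" using E_subset finite_V finite_subset by blast
  then have wf: "wf E" using acyclic_E finite_acyclic_wf by blast
  have "j \<in> completed s" if "j \<in> V" for j
    using wf that
  proof (induction j rule: wf_induct_rule)
    case (less j)
    then have "\<forall>i. (i, j) \<in> E \<longrightarrow> i \<in> completed s" using E_subset by auto
    then show ?case using assms(2,3) q less by (auto simp: settled_def newly_available_def)
  qed
  then show "completed s = V" using assms(1) by (auto simp: well_formed_def active_def)
qed

text \<open>At the end \<open>work\<close> is the total area and the clock bounds the makespan, so
  the charge of a completed task gives the estimate. The disjunct \<open>T \<le> 0\<close> covers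
  the empty graph, which has no chain.\<close>

theorem makespan_le_area_plus_chain:
  assumes "produces \<alpha> \<mu> P V E k T"
  obtains q where "\<And>j. j \<in> V \<Longrightarrow> allocation \<alpha> \<mu> P (k j) (q j)"
    and "T \<le> 0 \<or> (\<exists>C j. chain E C j \<and> C \<subseteq> V
      \<and> (1 - \<mu>) * T \<le> (\<Sum>j\<in>V. area (k j) (q j)) / real P + (\<Sum>i\<in>C. weight q i))"
proof -
  obtain s where s: "reachable \<alpha> \<mu> P V E k s" "running s = {}"
    and T: "T = makespan V k (start s) (procs s)"
    using assms by (auto simp: produces_def)
  have inv: "well_formed s" "deficit_charged s" "settled s"
    using reachable_invariant[OF s(1)] by auto
  note final = terminal_completed[OF inv(1,3) s(2)]
  have active: "active s = V" using final s by (simp add: active_def)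
  have T_clock: "T \<le> max 0 (clock s)"
    using inv(1) finite_V by (auto simp: T makespan_def well_formed_def final le_max_iff_disj)
  have alloc: "allocation \<alpha> \<mu> P (k j) (procs s j)" if "j \<in> V" for j
    using inv(1) that by (auto simp: well_formed_def active)
  show ?thesis
  proof (rule that)
    show "allocation \<alpha> \<mu> P (k j) (procs s j)" if "j \<in> V" for j
      using alloc that .
    show "T \<le> 0 \<or> (\<exists>C j. chain E C j \<and> C \<subseteq> V
      \<and> (1 - \<mu>) * T \<le> (\<Sum>j\<in>V. area (k j) (procs s j)) / real P
        + (\<Sum>i\<in>C. weight (procs s) i))"
    proof (cases "T \<le> 0")
      case False
      then have Tc: "T \<le> clock s" "clock s \<noteq> 0" using T_clock by auto
      then obtain j where "chain_bounded s j (deficit s)"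
        using inv(2) by (auto simp: deficit_charged_def)
      then obtain C where C: "chain E C j" "C \<subseteq> V"
          "deficit s \<le> (\<Sum>i\<in>C. weight (procs s) i)"
        by (auto simp: chain_bounded_def active)
      have "(1 - \<mu>) * T \<le> (1 - \<mu>) * clock s" using Tc \<mu> by (intro mult_left_mono) auto
      then show ?thesis using C by (auto simp: deficit_def work_def s final)
    qed simp
  qed
qed

end


section \<open>Feasible schedules\<close>

lemma finish_le_makespan:
  "finite V \<Longrightarrow> j \<in> V \<Longrightarrow> finish k S q j \<le> makespan V k S q"
  by (simp add: makespan_def)

lemma feasible_chain_le:
  assumes G: "task_graph V E k" and feas: "feasible P V E k S q"
    and "chain E C j" "C \<subseteq> V"
  shows "(\<Sum>i\<in>C. exec_time (k i) (q i)) \<le> finish k S q j"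
  using assms(3,4)
proof (induction rule: chain.induct)
  case (single j)
  then show ?case using feas by (auto simp: feasible_def finish_def)
next
  case (extend C i j)
  have "finish k S q i \<le> S j" using extend feas by (auto simp: feasible_def)
  moreover have "j \<notin> C" using chain_extend_fresh extend G by (metis task_graph_def)
  ultimately show ?case using extend chain_finite[of E C i] by (simp add: finish_def)
qed

text \<open>Integrate the number of busy processors over time: it is at most \<open>P\<close> on
  \<open>[0, M]\<close>, with \<open>M\<close> the makespan, and vanishes elsewhere.\<close>

lemma feasible_area_le:
  assumes G: "task_graph V E k" and feas: "feasible P V E k S q"
  shows "(\<Sum>j\<in>V. area (k j) (q j)) \<le> real P * makespan V k S q"
proof -
  let ?F = "finish k S q" and ?M = "makespan V k S q"
  have fin: "finite V" using G by (simp add: task_graph_def)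
  have M0: "0 \<le> ?M" using fin by (simp add: makespan_def)
  have S0: "0 \<le> S j" and SF: "S j \<le> ?F j" and FM: "?F j \<le> ?M" if "j \<in> V" for j
  proof -
    have "1 \<le> q j" "valid_task (k j)" using that G feas by (auto simp: feasible_def task_graph_def)
    then show "S j \<le> ?F j" using exec_time_nonneg by (simp add: finish_def)
    show "0 \<le> S j" using that feas by (simp add: feasible_def)
    show "?F j \<le> ?M" using that fin by (rule finish_le_makespan[rotated])
  qed
  have int: "integrable lborel (\<lambda>x. c * indicator {a..<b} x)" for a b c :: real
    by (intro integrable_mult_right integrable_real_indicator) (cases "a \<le> b"; simp)+
  have intM: "integrable lborel (\<lambda>x. real P * indicator {0..?M} x)"
    using M0 by (intro integrable_mult_right integrable_real_indicator) simp_all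
  have "(\<Sum>j\<in>V. area (k j) (q j))
      = (\<Sum>j\<in>V. integral\<^sup>L lborel (\<lambda>x. real (q j) * indicator {S j..<?F j} x))"
    using SF by (intro sum.cong) (auto simp: area_def finish_def)
  also have "\<dots> = integral\<^sup>L lborel (\<lambda>x. \<Sum>j\<in>V. real (q j) * indicator {S j..<?F j} x)"
    by (rule Bochner_Integration.integral_sum[symmetric]) (rule int)
  also have "\<dots> \<le> integral\<^sup>L lborel (\<lambda>x. real P * indicator {0..?M} x)"
  proof (rule integral_mono)
    show "integrable lborel (\<lambda>x. \<Sum>j\<in>V. real (q j) * indicator {S j..<?F j} x)"
      by (rule Bochner_Integration.integrable_sum) (rule int)
    fix x :: real
    \<comment> \<open>Half-open intervals make the integrand equal, at every point, to the load in
      \<open>feasible\<close>.\<close>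
    have *: "(\<Sum>j\<in>V. real (q j) * indicator {S j..<?F j} x)
        = real (\<Sum>j | j \<in> V \<and> S j \<le> x \<and> x < ?F j. q j)"
      using fin by (auto simp: indicator_def sum.inter_filter[symmetric] intro!: sum.cong)
    show "(\<Sum>j\<in>V. real (q j) * indicator {S j..<?F j} x) \<le> real P * indicator {0..?M} x"
    proof (cases "x \<in> {0..?M}")
      case True
      have "(\<Sum>j | j \<in> V \<and> S j \<le> x \<and> x < ?F j. q j) \<le> P"
        using feas by (simp add: feasible_def)
      then have "real (\<Sum>j | j \<in> V \<and> S j \<le> x \<and> x < ?F j. q j) \<le> real P"
        by (rule of_nat_mono)
      then show ?thesis using True unfolding * by (simp del: of_nat_sum)
    next
      case False
      then have "x \<notin> {S j..<?F j}" if "j \<in> V" for j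
        using S0[OF that] FM[OF that] by auto
      then have "(\<Sum>j\<in>V. real (q j) * indicator {S j..<?F j} x) = 0"
        by (intro sum.neutral) simp
      then show ?thesis by simp
    qed
  qed (rule intM)
  also have "\<dots> = real P * ?M" using M0 by simp
  finally show ?thesis .
qed

text \<open>Without a feasible schedule \<open>opt_makespan\<close> would be the unspecified infimum of the empty
  set. The witness runs the tasks one after the other on one processor each.\<close>

lemma ex_sequential_schedule:
  assumes "finite V" "acyclic E" "\<forall>j\<in>V. valid_task (k j)"
  shows "\<exists>S M. 0 \<le> M \<and> (\<forall>j\<in>V. 0 \<le> S j \<and> finish k S (\<lambda>_. 1) j \<le> M)
    \<and> (\<forall>i\<in>V. \<forall>j\<in>V. (i, j) \<in> E \<longrightarrow> finish k S (\<lambda>_. 1) i \<le> S j)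
    \<and> (\<forall>x. card {j \<in> V. S j \<le> x \<and> x < finish k S (\<lambda>_. 1) j} \<le> 1)"
  using assms(1,3)
proof (induction "card V" arbitrary: V)
  case 0
  then show ?case by (intro exI[of _ "\<lambda>_. 0"] exI[of _ 0]) auto
next
  case (Suc n)
  have "V \<noteq> {}" using Suc(2) by auto
  then obtain v where v: "v \<in> V" "\<And>j. j \<in> V \<Longrightarrow> (v, j) \<notin> E"
  proof -
    \<comment> \<open>A minimal element of the reversed edge relation on \<open>V\<close> is a sink;
      it can be scheduled last.\<close>
    let ?R = "(E \<inter> V \<times> V)\<inverse>"
    have "acyclic ?R" using assms(2) by (auto intro: acyclic_subset simp: acyclic_converse)
    moreover have "finite ?R" using Suc by (simp add: finite_subset[of _ "V \<times> V"])
    ultimately have "wf ?R" by (simp add: finite_acyclic_wf)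
    then obtain v where "v \<in> V" "\<And>j. (j, v) \<in> ?R \<Longrightarrow> j \<notin> V"
      using \<open>V \<noteq> {}\<close> by (metis all_not_in_conv wfE_min)
    then show ?thesis using that by blast
  qed
  let ?V = "V - {v}"
  have "n = card ?V" using Suc v by simp
  moreover have "finite ?V" "\<forall>j\<in>?V. valid_task (k j)" using Suc(3,4) by auto
  ultimately obtain S M where IH: "0 \<le> M" "\<forall>j\<in>?V. 0 \<le> S j \<and> finish k S (\<lambda>_. 1) j \<le> M"
      "\<forall>i\<in>?V. \<forall>j\<in>?V. (i, j) \<in> E \<longrightarrow> finish k S (\<lambda>_. 1) i \<le> S j"
      "\<forall>x. card {j \<in> ?V. S j \<le> x \<and> x < finish k S (\<lambda>_. 1) j} \<le> 1"
    using Suc(1)[of ?V] by blast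
  note S = IH(1) IH(2)[rule_format] IH(3)[rule_format] IH(4)[rule_format]
  \<comment> \<open>The sink starts at \<open>M\<close>, when all other tasks have finished.\<close>
  define S' where "S' = S(v := M)"
  have fin_v: "finish k S' (\<lambda>_. 1) v = M + exec_time (k v) 1"
    and fin_old: "\<And>j. j \<noteq> v \<Longrightarrow> finish k S' (\<lambda>_. 1) j = finish k S (\<lambda>_. 1) j"
    by (auto simp: finish_def S'_def)
  have tv: "0 \<le> exec_time (k v) 1" using exec_time_nonneg Suc v by simp
  show ?case
  proof (intro exI[of _ S'] exI[of _ "M + exec_time (k v) 1"] conjI ballI allI impI)
    fix j assume "j \<in> V"
    show "0 \<le> S' j" using \<open>j \<in> V\<close> S(1) S(2)[of j] by (simp add: S'_def)
    show "finish k S' (\<lambda>_. 1) j \<le> M + exec_time (k v) 1"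
    proof (cases "j = v")
      case True
      then show ?thesis using fin_v by simp
    next
      case False
      then have "finish k S (\<lambda>_. 1) j \<le> M" using \<open>j \<in> V\<close> S(2) by simp
      then show ?thesis using tv fin_old[OF False] by linarith
    qed
  next
    fix i j assume ij: "i \<in> V" "j \<in> V" "(i, j) \<in> E"
    then have "i \<noteq> v" using v by auto
    then show "finish k S' (\<lambda>_. 1) i \<le> S' j"
      unfolding fin_old[OF \<open>i \<noteq> v\<close>] unfolding S'_def
      using ij S(2)[of i] S(3)[of i j] by (cases "j = v") auto
  next
    fix x
    show "card {j \<in> V. S' j \<le> x \<and> x < finish k S' (\<lambda>_. 1) j} \<le> 1"
    proof (cases "x < M")
      case True
      then have "{j \<in> V. S' j \<le> x \<and> x < finish k S' (\<lambda>_. 1) j}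
          = {j \<in> ?V. S j \<le> x \<and> x < finish k S (\<lambda>_. 1) j}"
        by (auto simp: finish_def S'_def)
      then show ?thesis using S(4) by simp
    next
      case False
      have "j = v" if "j \<in> V" "x < finish k S' (\<lambda>_. 1) j" for j
      proof (rule ccontr)
        assume "j \<noteq> v"
        then show False using that False S(2)[of j] fin_old[of j] by simp
      qed
      then have "{j \<in> V. S' j \<le> x \<and> x < finish k S' (\<lambda>_. 1) j} \<subseteq> {v}" by blast
      from card_mono[OF _ this] show ?thesis by simp
    qed
  qed (use S tv in auto)
qed

lemma ex_feasible:
  assumes "1 \<le> P" "task_graph V E k"
  shows "\<exists>S q. feasible P V E k S q"
proof -
  obtain S where S: "\<forall>j\<in>V. 0 \<le> S j" "\<forall>i\<in>V. \<forall>j\<in>V. (i, j) \<in> E \<longrightarrow> finish k S (\<lambda>_. 1) i \<le> S j"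
      "\<forall>x. card {j \<in> V. S j \<le> x \<and> x < finish k S (\<lambda>_. 1) j} \<le> 1"
    using ex_sequential_schedule[of V E k] assms unfolding task_graph_def by blast
  have "card {j \<in> V. S j \<le> x \<and> x < finish k S (\<lambda>_. 1) j} \<le> P" for x
    using S(3) assms(1) order_trans by blast
  then have "feasible P V E k S (\<lambda>_. 1)"
    using S assms unfolding feasible_def task_graph_def by auto
  then show ?thesis by blast
qed


section \<open>Competitive ratio\<close>

theorem competitive:
  assumes P: "1 \<le> P" and G: "task_graph V E k"
    and \<mu>: "0 < \<mu>" "\<mu> \<le> 1 / 2" and \<mu>_le: "2 * \<mu> * (1 - \<mu>) \<le> 1 - 3 * \<mu>"
    and T: "produces 2 \<mu> P V E k T"
  shows "T \<le> 1 / \<mu> * opt_makespan P V E k"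
proof -
  interpret list_scheduling P V E k 2 \<mu>
    by unfold_locales (use assms in auto)
  obtain q where q: "\<And>j. j \<in> V \<Longrightarrow> allocation 2 \<mu> P (k j) (q j)"
    and bound: "T \<le> 0 \<or> (\<exists>C j. chain E C j \<and> C \<subseteq> V
      \<and> (1 - \<mu>) * T \<le> (\<Sum>j\<in>V. area (k j) (q j)) / real P + (\<Sum>i\<in>C. weight q i))"
    using makespan_le_area_plus_chain[OF T] by blast
  \<comment> \<open>Proved against every feasible schedule, so that it passes to the
    infimum.\<close>
  have "\<mu> * T \<le> makespan V k S r" if feas: "feasible P V E k S r" for S r
  proof (cases "T \<le> 0")
    case True
    moreover have "0 \<le> makespan V k S r" using finite_V by (simp add: makespan_def)
    ultimately show ?thesis using \<mu>(1) by (meson mult_nonneg_nonpos less_imp_le order_trans)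
  next
    case False
    then obtain C j where C: "chain E C j" "C \<subseteq> V"
      and le: "(1 - \<mu>) * T \<le> (\<Sum>j\<in>V. area (k j) (q j)) / real P + (\<Sum>i\<in>C. weight q i)"
      using bound by blast
    let ?M = "makespan V k S r"
    have r: "1 \<le> r j" "r j \<le> P" if "j \<in> V" for j using feas that by (auto simp: feasible_def)
    have X: "0 \<le> 1 / \<mu> - 3"
    proof -
      have "0 \<le> 2 * \<mu> * (1 - \<mu>)" using \<mu> by simp
      then have "3 * \<mu> \<le> 1" using \<mu>_le by linarith
      then show ?thesis using \<mu>(1) by (simp add: field_simps)
    qed
    have chain_le: "(\<Sum>i\<in>C. exec_time (k i) (r i)) \<le> ?M"
    proof -
      have "j \<in> V" using C by (auto elim: chain.cases)
      then show ?thesis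
        using feasible_chain_le[OF G feas C] finish_le_makespan[OF finite_V, of j k S r] by simp
    qed
    have area_le: "(\<Sum>j\<in>V. area (k j) (r j)) / real P \<le> ?M"
      using feasible_area_le[OF G feas] P by (simp add: field_simps)
    have "(\<Sum>j\<in>V. area (k j) (q j)) = (\<Sum>j\<in>V - C. area (k j) (q j)) + (\<Sum>j\<in>C. area (k j) (q j))"
      using sum.subset_diff[OF C(2) finite_V] .
    then have "(1 - \<mu>) * T \<le> (\<Sum>j\<in>V - C. area (k j) (q j)) / real P
        + (\<Sum>i\<in>C. weight q i + area (k i) (q i) / real P)"
      using le by (simp add: sum.distrib add_divide_distrib sum_divide_distrib)
    also have "\<dots> \<le> (\<Sum>j\<in>V - C. 2 * area (k j) (r j)) / real P
        + (\<Sum>i\<in>C. (1 / \<mu> - 3) * exec_time (k i) (r i) + 2 * area (k i) (r i) / real P)"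
    proof (rule add_mono[OF divide_right_mono[OF sum_mono] sum_mono])
      fix j assume "j \<in> V - C"
      then have j: "j \<in> V" by simp
      show "area (k j) (q j) \<le> 2 * area (k j) (r j)"
        using allocation_area_le[OF valid[OF j] P \<mu>(1) q[OF j]]
          area_mono[OF valid[OF j] order.refl r(1)[OF j]] by simp
    next
      fix i assume "i \<in> C"
      then have i: "i \<in> V" using C by auto
      show "weight q i + area (k i) (q i) / real P
          \<le> (1 / \<mu> - 3) * exec_time (k i) (r i) + 2 * area (k i) (r i) / real P"
        using allocation_tradeoff[OF valid[OF i] P \<mu> \<mu>_le q[OF i] r[OF i]] .
    qed simp
    also have "\<dots> = (1 / \<mu> - 3) * (\<Sum>i\<in>C. exec_time (k i) (r i))
        + 2 * ((\<Sum>j\<in>V. area (k j) (r j)) / real P)"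
      unfolding sum.subset_diff[OF C(2) finite_V]
      by (simp add: sum.distrib sum_distrib_left sum_divide_distrib add_divide_distrib)
    also have "\<dots> \<le> (1 / \<mu> - 3) * ?M + 2 * ?M"
      using chain_le area_le X by (intro add_mono mult_left_mono) auto
    \<comment> \<open>\<open>1 / \<mu> - 3 + 2 = (1 - \<mu>) / \<mu>\<close>, so the factor
      \<open>1 - \<mu>\<close> cancels.\<close>
    also have "\<dots> = (1 - \<mu>) * (?M / \<mu>)" using \<mu> by (simp add: field_simps)
    finally have "T \<le> ?M / \<mu>" by (rule mult_left_le_imp_le) (use \<mu> in simp)
    then show ?thesis using \<mu> by (simp add: field_simps)
  qed
  then have "\<mu> * T \<le> opt_makespan P V E k"
    unfolding opt_makespan_def using ex_feasible[OF P G] by (intro cInf_greatest) auto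
  then show ?thesis using \<mu> by (simp add: field_simps)
qed

theorem theorem4:
  fixes P :: nat and V :: "'a set" and E :: "('a \<times> 'a) set"
    and k :: "'a \<Rightarrow> moldable_task" and T :: real
  assumes "P \<ge> 1"
    and "task_graph V E k"
    and "produces 2 ((33 - sqrt 738) / 27) P V E k T"
  shows "27 / (33 - sqrt 738) < 4.63 \<and> T \<le> 27 / (33 - sqrt 738) * opt_makespan P V E k"
proof -
  define \<mu> :: real where "\<mu> = (33 - sqrt 738) / 27"
  \<comment> \<open>The lower bound yields \<open>\<mu> \<le> 0.217\<close>; the upper bound is
    sharp enough for the ratio to stay below 4.63.\<close>
  have "27.16 < sqrt 738" by (rule real_less_rsqrt) (simp add: power2_eq_square)
  moreover have "sqrt 738 < 27.168" by (rule real_less_lsqrt) (simp_all add: power2_eq_square)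
  ultimately have b: "27.16 < sqrt 738" "sqrt 738 < 27.168" by auto
  then have \<mu>: "0 < \<mu>" "\<mu> \<le> 1 / 2" by (auto simp: \<mu>_def)
  have "sqrt 738 * sqrt 738 = (738 :: real)" by simp
  \<comment> \<open>\<open>\<mu>\<close> is the smaller root of
    \<open>27 x^2 - 66 x + 13\<close>.\<close>
  then have "27 * (\<mu> * \<mu>) = 66 * \<mu> - 13"
    by (simp add: \<mu>_def field_simps)
  moreover have "\<mu> \<le> 0.217" using b by (simp add: \<mu>_def)
  \<comment> \<open>Eliminating the square turns this condition into
    \<open>3 * \<mu> \<le> 1\<close>.\<close>
  ultimately have "2 * \<mu> * (1 - \<mu>) \<le> 1 - 3 * \<mu>" by (simp add: algebra_simps)
  then have "T \<le> 1 / \<mu> * opt_makespan P V E k"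
    using assms \<mu> by (intro competitive) (auto simp: \<mu>_def)
  moreover have "27 / (33 - sqrt 738) < (4.63 :: real)" using b by (simp add: field_simps)
  ultimately show ?thesis by (simp add: \<mu>_def)
qed

end
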